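(* The function $$z\mapsto f_{\nu}(z)=\left(2^{\nu}\Gamma(\nu+1)J_{\nu}(z)\right)^{\frac{1}{\nu}}$$ is starlike of order $\alpha\in[0,1)$ in $\mathbb{D}$ if and only if $\nu>\nu_1(\alpha)$, where $\nu_1(\alpha)$ is the unique root of the equation (in the unknown $\nu$) $$(1-\alpha)\nu J_{\nu}(1)=J_{\nu+1}(1),$$ situated in $(0,\infty)$. In particular, $f_{\nu}$ is starlike in $\mathbb{D}$ if and only if $\nu>\nu_1(0)$, where $\nu_1(0)\simeq0.3908\dots$ is the unique root of the transcendental equation $\nu J_{\nu}(1)=J_{\nu+1}(1)$.
   Context: $\mathbb{D}=\{z\in\mathbb{C}:|z|<1\}$ is the open unit disk. $J_\nu$ is the Bessel function of the first kind of order $\nu$, $J_\nu(z)=\sum_{n\ge0}\frac{(-1)^n}{n!\,\Gamma(n+\nu+1)}\left(\frac z2\right)^{2n+\nu}$, and $\Gamma$ is the Euler gamma function. The function $f_\nu$ is understood as $f_\nu(z)=z\,h_\nu(z)^{1/\nu}$, where $h_\nu(z)=2^\nu\Gamma(\nu+1)z^{-\nu}J_\nu(z)$, $h_\nu(0)=1$, and the branch of $h_\nu^{1/\nu}$ is the one equal to $1$ at $z=0$. An analytic function $f$ on $\mathbb{D}$ with $f(0)=0$, $f'(0)=1$ is starlike of order $\alpha\in[0,1)$ in $\mathbb{D}$ if $\operatorname{Re}\left(zf'(z)/f(z)\right)>\alpha$ for all $z\in\mathbb{D}$; starlike means starlike of order $0$.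
   Formalization: Proved for real ν>-1, ν≠0 (the claim fails e.g. at ν=-10.5), with ν≥ν₁(α) in place of ν>ν₁(α), since f_ν is starlike of order α on the open disk also at ν=ν₁(α); the value 0.3908… is corrected to 0.3900<ν₁(0)<0.3901. *)

theory Defs
  imports "HOL-Complex_Analysis.Complex_Analysis"
begin

(* Principal branch of (z/2) powr (2n + nu).  As 0 powr 0 = 0 in HOL, the value at z = 0 is 0
   even for nu = 0. *)
definition bessel_J :: "real \<Rightarrow> complex \<Rightarrow> complex" where
  "bessel_J \<nu> z = (\<Sum>n. (-1) ^ n / (fact n * Gamma (of_real (real n + \<nu> + 1)))
                         * (z / 2) powr of_real (2 * real n + \<nu>))"

(* The two principal powers z powr (-nu) and (z/2) powr nu cancel without a jump, so this is the
   even power series sum_n (-1)^n Gamma(nu+1) / (n! Gamma(n+nu+1)) (z/2)^(2n) for nu > -1. *)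
definition bessel_h :: "real \<Rightarrow> complex \<Rightarrow> complex" where
  "bessel_h \<nu> z = (if z = 0 then 1
     else 2 powr of_real \<nu> * Gamma (of_real (\<nu> + 1)) * z powr (- of_real \<nu>) * bessel_J \<nu> z)"

(* f is the analytic function z * h(z)^(1/nu) on the unit disk, with the branch of the root that is
   1 at 0.  Near 0, where h is close to 1, this branch is the principal power; by the identity
   theorem that determines f on the whole disk.  No such f need exist if h vanishes in the disk. *)
definition is_bessel_f :: "real \<Rightarrow> (complex \<Rightarrow> complex) \<Rightarrow> bool" where
  "is_bessel_f \<nu> f \<longleftrightarrow> f holomorphic_on ball 0 1 \<and>
     (\<forall>\<^sub>F z in nhds 0. f z = z * bessel_h \<nu> z powr of_real (1 / \<nu>))"

(* At 0 the quotient has a removable singularity with value 1, while HOL would give 0 / 0 = 0;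
   hence 0 is left out.  At any other zero of f the quotient is 0 in HOL, so the condition fails
   there for alpha >= 0, as it should.  The strict bound is required on the open disk only: it still
   holds if the infimum alpha is reached just on the boundary. *)
definition starlike_of_order :: "real \<Rightarrow> (complex \<Rightarrow> complex) \<Rightarrow> bool" where
  "starlike_of_order \<alpha> f \<longleftrightarrow> f holomorphic_on ball 0 1 \<and> f 0 = 0 \<and> deriv f 0 = 1 \<and>
     (\<forall>z \<in> ball 0 1 - {0}. Re (z * deriv f z / f z) > \<alpha>)"

definition is_nu1 :: "real \<Rightarrow> real \<Rightarrow> bool" where
  "is_nu1 \<alpha> \<nu> \<longleftrightarrow> \<nu> > 0 \<and>
     of_real ((1 - \<alpha>) * \<nu>) * bessel_J \<nu> 1 = bessel_J (\<nu> + 1) 1"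

definition nu1 :: "real \<Rightarrow> real" where
  "nu1 \<alpha> = (THE \<nu>. is_nu1 \<alpha> \<nu>)"

end

theory Submission
  imports Defs
begin

text \<open>
  Write \<open>h(z) = G(z\<^sup>2)\<close> with the entire function
  \<open>G(w) = \<Sum>n. (-1)\<^sup>n w\<^sup>n / (4\<^sup>n n! (\<nu>+1)\<^sub>n)\<close>. The logarithmic derivative
  of \<open>f(z) = z h(z)\<^bsup>1/\<nu>\<^esup>\<close> is given by
  \<open>z f'(z) / f(z) = 1 + (2/\<nu>) w G'(w) / G(w)\<close> with \<open>w = z\<^sup>2\<close>. Everything hinges on the series
  \<open>L(w) = - w G'(w) / G(w) = \<Sum>k. \<sigma>\<^sub>k w\<^sup>k\<close>. Classically \<open>\<sigma>\<^sub>k\<close> is Rayleigh's sum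
  of \<open>j\<close> to the power \<open>-2k\<close> over the positive zeros \<open>j\<close> of the Bessel function. The proof
  makes no use of the zeros: Bessel's equation for \<open>G\<close> is a linear equation of second order, so \<open>L\<close>
  satisfies the Riccati equation \<open>w L' + \<nu> L = L\<^sup>2 + w/4\<close>, and comparing coefficients yields the
  recursion \<open>(k + \<nu>) \<sigma>\<^sub>k = (\<Sum>i. \<sigma>\<^sub>i \<sigma>\<^bsub>k-i\<^esub>)\<close> for \<open>k \<ge> 2\<close>, starting from
  \<open>\<sigma>\<^sub>0 = 0\<close> and \<open>\<sigma>\<^sub>1 = 1 / (4 (\<nu>+1))\<close>. Here the recursion is taken as the definition of
  the \<open>\<sigma>\<^sub>k\<close>, and \<open>bessel_fps_log_deriv\<close> proves that they are the coefficients of \<open>L\<close>.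

  For \<open>\<nu> \<ge> 0\<close> the recursion shows at once that the \<open>\<sigma>\<^sub>k\<close> are nonnegative, that they are
  continuous and decreasing in \<open>\<nu>\<close>, and that \<open>\<sigma>\<^sub>k \<le> \<sigma>\<^sub>1\<^sup>k\<close>. Nonnegative coefficients mean that
  \<open>Re L(w) < L(1)\<close> on the open unit disk, with \<open>L(1)\<close> approached along the real axis. Hence for
  \<open>\<nu> > 0\<close> the infimum of \<open>Re (z f'/f)\<close> is \<open>1 - 2 L(1) / \<nu>\<close>, it is not attained, and
  starlikeness of order \<open>\<alpha>\<close> amounts to \<open>2 L(1) \<le> (1 - \<alpha>) \<nu>\<close> (\<open>starlike_iff_pos\<close>). The
  left side decreases with \<open>\<nu>\<close> and the right side increases strictly from 0, so there is exactly
  one point of equality and the inequality holds precisely from there on. Since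
  \<open>J\<^bsub>\<nu>+1\<^esub>(1) = 2 L(1) J\<^sub>\<nu>(1)\<close> (\<open>bessel_J_ratio\<close>), that point is \<open>nu1\<close>. It is
  located numerically by five of the \<open>\<sigma>\<^sub>k\<close> and a geometric bound for the rest.

  For \<open>-1 < \<nu> < 0\<close> the factor \<open>1/\<nu>\<close> is negative, so the critical points move to the imaginary
  axis, where \<open>G\<close> has positive terms. At \<open>z = 9\<i>/10\<close> the first two terms of the series already
  force \<open>Re (z f'/f) < 0\<close> (\<open>not_starlike_neg\<close>).
\<close>

section \<open>The Rayleigh functions as functions of the order\<close>

text \<open>
  These are the power sums \<open>\<Sum>j. 1 / j\<^bsup>2n\<^esup>\<close> over the positive zeros \<open>j\<close> of the Bessel
  function of order \<open>\<nu>\<close>, introduced by Rayleigh's recursion. The value 0 at \<open>n = 0\<close> is the constant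
  coefficient of the logarithmic derivative; it makes full convolutions agree with the sums below.
\<close>

fun rayleigh :: "real \<Rightarrow> nat \<Rightarrow> real" where
  "rayleigh \<nu> n = (if n = 0 then 0 else if n = 1 then 1 / (4 * (\<nu> + 1))
     else (\<Sum>k = 1..<n. rayleigh \<nu> k * rayleigh \<nu> (n - k)) / (real n + \<nu>))"

declare rayleigh.simps [simp del]

lemma rayleigh_0 [simp]: "rayleigh \<nu> 0 = 0"
  and rayleigh_1 [simp]: "rayleigh \<nu> (Suc 0) = 1 / (4 * (\<nu> + 1))"
  by (simp_all add: rayleigh.simps)

lemma rayleigh_step:
  "n \<ge> 2 \<Longrightarrow> rayleigh \<nu> n = (\<Sum>k = 1..<n. rayleigh \<nu> k * rayleigh \<nu> (n - k)) / (real n + \<nu>)"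
  by (subst rayleigh.simps) simp

text \<open>
  The form of the recursion that is uniform in \<open>n\<close>: this is the coefficientwise Riccati equation.
\<close>

lemma rayleigh_convolution:
  assumes "\<nu> > -1"
  shows "(real n + \<nu>) * rayleigh \<nu> n =
    (if n = 1 then 1 / 4 else 0) + (\<Sum>k = 0..n. rayleigh \<nu> k * rayleigh \<nu> (n - k))"
proof -
  consider "n = 0" | "n = 1" | "n \<ge> 2" by linarith
  then show ?thesis
  proof cases
    case 3
    have "(\<Sum>k = 1..<n. rayleigh \<nu> k * rayleigh \<nu> (n - k)) =
          (\<Sum>k = 0..n. rayleigh \<nu> k * rayleigh \<nu> (n - k))"
      by (rule sum.mono_neutral_left) (auto simp: not_less Suc_le_eq)
    with 3 assms show ?thesis by (subst rayleigh_step) (auto simp: field_simps)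
  qed (use assms in \<open>auto simp: field_simps\<close>)
qed

lemma rayleigh_nonneg: "\<nu> \<ge> 0 \<Longrightarrow> rayleigh \<nu> n \<ge> 0"
proof (induction n rule: less_induct)
  case (less n)
  have "(\<Sum>k = 1..<n. rayleigh \<nu> k * rayleigh \<nu> (n - k)) \<ge> 0"
    by (intro sum_nonneg mult_nonneg_nonneg less) auto
  then show ?case using less.prems by (subst rayleigh.simps) auto
qed

lemma rayleigh_antimono: "0 \<le> \<mu> \<Longrightarrow> \<mu> \<le> \<nu> \<Longrightarrow> rayleigh \<nu> n \<le> rayleigh \<mu> n"
proof (induction n rule: less_induct)
  case (less n)
  show ?case
  proof (cases "n \<ge> 2")
    case True
    have "(\<Sum>k = 1..<n. rayleigh \<nu> k * rayleigh \<nu> (n - k))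
          \<le> (\<Sum>k = 1..<n. rayleigh \<mu> k * rayleigh \<mu> (n - k))"
      using less.prems by (intro sum_mono mult_mono less.IH rayleigh_nonneg) auto
    then show ?thesis using True less.prems
      by (simp add: rayleigh_step) (intro frac_le sum_nonneg mult_nonneg_nonneg rayleigh_nonneg; simp)
  next
    case False
    then have "n = 0 \<or> n = 1" by auto
    then show ?thesis using less.prems by (auto intro!: frac_le)
  qed
qed

text \<open>
  The convolution has \<open>n - 1\<close> terms and is divided by \<open>n + \<nu>\<close>, so a geometric bound
  with constant 1 reproduces itself. It serves both as radius of convergence and as tail estimate.
\<close>

lemma rayleigh_le_power: "\<nu> \<ge> 0 \<Longrightarrow> rayleigh \<nu> n \<le> (1 / (4 * (\<nu> + 1))) ^ n"
proof (induction n rule: less_induct)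
  case (less n)
  let ?s = "1 / (4 * (\<nu> + 1))"
  show ?case
  proof (cases "n \<ge> 2")
    case True
    have "(\<Sum>k = 1..<n. rayleigh \<nu> k * rayleigh \<nu> (n - k)) \<le> (\<Sum>k = 1..<n. ?s ^ k * ?s ^ (n - k))"
      using less.prems by (intro sum_mono mult_mono less.IH rayleigh_nonneg) auto
    also have "\<dots> = (\<Sum>k = 1..<n. ?s ^ n)"
      by (intro sum.cong) (auto simp flip: power_add)
    also have "\<dots> = real (n - 1) * ?s ^ n" by simp
    also have "\<dots> \<le> (real n + \<nu>) * ?s ^ n"
      using less.prems by (intro mult_right_mono) auto
    finally show ?thesis using True less.prems
      by (simp add: rayleigh_step pos_divide_le_eq mult.commute)
  next
    case False
    then have "n = 0 \<or> n = 1" by auto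
    then show ?thesis by auto
  qed
qed

lemma rayleigh_le_quarter_power:
  assumes "\<nu> \<ge> 0"
  shows "rayleigh \<nu> n \<le> (1 / 4) ^ n"
proof -
  have "(1 / (4 * (\<nu> + 1))) ^ n \<le> (1 / 4) ^ n"
    using assms by (intro power_mono frac_le) auto
  with rayleigh_le_power[OF assms, of n] show ?thesis by linarith
qed

lemma continuous_on_rayleigh: "continuous_on {0..} (\<lambda>\<nu>. rayleigh \<nu> n)"
proof (induction n rule: less_induct)
  case (less n)
  show ?case
  proof (cases "n \<ge> 2")
    case True
    then show ?thesis
      by (simp add: rayleigh_step) (intro continuous_intros less; auto)
  next
    case False
    then have "n = 0 \<or> n = 1" by auto
    then show ?thesis by (auto intro!: continuous_intros)
  qed
qed

section \<open>The sum of all Rayleigh functions\<close>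

definition rayleigh_sum :: "real \<Rightarrow> real" where
  "rayleigh_sum \<nu> = (\<Sum>n. rayleigh \<nu> n)"

lemma summable_rayleigh: "\<nu> \<ge> 0 \<Longrightarrow> summable (rayleigh \<nu>)"
  by (rule summable_comparison_test'[of "\<lambda>n. (1/4) ^ n" 0])
     (auto simp: rayleigh_nonneg rayleigh_le_quarter_power)

lemma rayleigh_sum_antimono:
  "0 \<le> \<mu> \<Longrightarrow> \<mu> \<le> \<nu> \<Longrightarrow> rayleigh_sum \<nu> \<le> rayleigh_sum \<mu>"
  unfolding rayleigh_sum_def by (intro suminf_le rayleigh_antimono summable_rayleigh) auto

lemma rayleigh_sum_ge_partial: "\<nu> \<ge> 0 \<Longrightarrow> (\<Sum>n<N. rayleigh \<nu> n) \<le> rayleigh_sum \<nu>"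
  unfolding rayleigh_sum_def by (intro sum_le_suminf summable_rayleigh) (auto simp: rayleigh_nonneg)

lemma rayleigh_sum_le_partial:
  fixes \<nu> :: real
  assumes "\<nu> \<ge> 0"
  defines "s \<equiv> 1 / (4 * (\<nu> + 1))"
  shows "rayleigh_sum \<nu> \<le> (\<Sum>n<N. rayleigh \<nu> n) + s ^ N / (1 - s)"
proof -
  have s: "0 \<le> s" "s < 1" using assms by (auto simp: s_def)
  have "(\<lambda>n. s ^ N * s ^ n) sums (s ^ N * (1 / (1 - s)))"
    using s by (intro sums_mult geometric_sums) auto
  then have gs: "(\<lambda>n. s ^ (n + N)) sums (s ^ N / (1 - s))"
    by (simp add: power_add mult.commute)
  have "(\<Sum>n. rayleigh \<nu> (n + N)) \<le> (\<Sum>n. s ^ (n + N))"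
  proof (rule suminf_le)
    show "rayleigh \<nu> (n + N) \<le> s ^ (n + N)" for n
      unfolding s_def by (rule rayleigh_le_power) fact
    show "summable (\<lambda>n. rayleigh \<nu> (n + N))"
      using assms(1) by (intro summable_ignore_initial_segment summable_rayleigh)
  qed (use gs in \<open>simp add: sums_iff\<close>)
  with gs show ?thesis unfolding rayleigh_sum_def
    using suminf_split_initial_segment[OF summable_rayleigh[OF assms(1)], of N]
    by (simp add: sums_iff)
qed

lemma rayleigh_sum_pos: "\<nu> \<ge> 0 \<Longrightarrow> rayleigh_sum \<nu> > 0"
  using rayleigh_sum_ge_partial[of \<nu> 2] by (rule less_le_trans[rotated]) (auto simp: eval_nat_numeral)

lemma continuous_on_rayleigh_sum: "continuous_on {0..} rayleigh_sum"
proof (rule uniform_limit_theorem)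
  show "uniform_limit {0..} (\<lambda>N \<nu>. \<Sum>n<N. rayleigh \<nu> n) rayleigh_sum sequentially"
    unfolding rayleigh_sum_def
    by (rule Weierstrass_m_test[where M = "\<lambda>n. (1/4) ^ n"])
       (auto simp: rayleigh_nonneg rayleigh_le_quarter_power)
qed (auto intro!: always_eventually continuous_on_sum continuous_on_rayleigh)

lemma rayleigh_2: "rayleigh \<nu> 2 = (rayleigh \<nu> 1)\<^sup>2 / (2 + \<nu>)"
  and rayleigh_3: "rayleigh \<nu> 3 = 2 * rayleigh \<nu> 1 * rayleigh \<nu> 2 / (3 + \<nu>)"
  and rayleigh_4: "rayleigh \<nu> 4 = (2 * rayleigh \<nu> 1 * rayleigh \<nu> 3 + (rayleigh \<nu> 2)\<^sup>2) / (4 + \<nu>)"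
  and rayleigh_5: "rayleigh \<nu> 5 =
        (2 * rayleigh \<nu> 1 * rayleigh \<nu> 4 + 2 * rayleigh \<nu> 2 * rayleigh \<nu> 3) / (5 + \<nu>)"
proof -
  have iv: "{1..<2} = {1::nat}" "{1..<3} = {1,2::nat}" "{1..<4} = {1,2,3::nat}" "{1..<5} = {1,2,3,4::nat}"
    by auto
  show "rayleigh \<nu> 2 = (rayleigh \<nu> 1)\<^sup>2 / (2 + \<nu>)"
    by (subst rayleigh_step) (simp_all add: iv[unfolded One_nat_def] power2_eq_square del: rayleigh_1)
  show "rayleigh \<nu> 3 = 2 * rayleigh \<nu> 1 * rayleigh \<nu> 2 / (3 + \<nu>)"
    by (subst rayleigh_step) (simp_all add: iv[unfolded One_nat_def] del: rayleigh_1)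
  show "rayleigh \<nu> 4 = (2 * rayleigh \<nu> 1 * rayleigh \<nu> 3 + (rayleigh \<nu> 2)\<^sup>2) / (4 + \<nu>)"
    by (subst rayleigh_step) (simp_all add: iv[unfolded One_nat_def] power2_eq_square del: rayleigh_1)
  show "rayleigh \<nu> 5 = (2 * rayleigh \<nu> 1 * rayleigh \<nu> 4 + 2 * rayleigh \<nu> 2 * rayleigh \<nu> 3) / (5 + \<nu>)"
    by (subst rayleigh_step) (simp_all add: iv[unfolded One_nat_def] del: rayleigh_1)
qed

lemma rayleigh_partial_sum_6:
  "(\<Sum>n<6. rayleigh \<nu> n) =
     rayleigh \<nu> 1 + rayleigh \<nu> 2 + rayleigh \<nu> 3 + rayleigh \<nu> 4 + rayleigh \<nu> 5"
proof -
  have "{..<6} = {0, 1, 2, 3, 4, 5 :: nat}" by auto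
  then show ?thesis by simp
qed

text \<open>
  The excess of the left side is about \<open>1.3 * 10\<^sup>-\<^sup>5\<close>, while \<open>\<sigma>\<^sub>5\<close> is about
  \<open>1.8 * 10\<^sup>-\<^sup>5\<close>: five Rayleigh functions suffice and four do not. As \<open>2 L(1) - \<nu>\<close> is
  decreasing, this bound and the next one enclose its zero.
\<close>

lemma rayleigh_sum_numeric_lower: "2 * rayleigh_sum (39 / 100) > 39 / 100"
  using rayleigh_sum_ge_partial[of "39/100" 6]
  unfolding rayleigh_partial_sum_6 rayleigh_5 rayleigh_4 rayleigh_3 rayleigh_2
  by (simp add: power2_eq_square)

lemma rayleigh_sum_numeric_upper: "2 * rayleigh_sum (3901 / 10000) < 3901 / 10000"
  using rayleigh_sum_le_partial[of "3901/10000" 6]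
  unfolding rayleigh_partial_sum_6 rayleigh_5 rayleigh_4 rayleigh_3 rayleigh_2
  by (simp add: power2_eq_square power_divide)

section \<open>The order equation\<close>

section \<open>The threshold order\<close>

lemma rayleigh_sum_crossing:
  assumes "0 \<le> \<alpha>" "\<alpha> < 1"
  obtains \<mu> where "0 < \<mu>"
    "\<And>\<nu>. \<nu> > 0 \<Longrightarrow> (1 - \<alpha>) * \<nu> = 2 * rayleigh_sum \<nu> \<longleftrightarrow> \<nu> = \<mu>"
    "\<And>\<nu>. \<nu> > 0 \<Longrightarrow> 2 * rayleigh_sum \<nu> \<le> (1 - \<alpha>) * \<nu> \<longleftrightarrow> \<mu> \<le> \<nu>"
proof -
  define \<phi> where "\<phi> \<nu> = (1 - \<alpha>) * \<nu> - 2 * rayleigh_sum \<nu>" for \<nu>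
  have less: "\<phi> \<nu> < \<phi> \<kappa>" if "0 \<le> \<nu>" "\<nu> < \<kappa>" for \<nu> \<kappa>
    using rayleigh_sum_antimono[of \<nu> \<kappa>] mult_strict_left_mono[of \<nu> \<kappa> "1 - \<alpha>"] that assms(2)
    unfolding \<phi>_def by linarith
  \<comment> \<open>At this point the line has reached the value that the decreasing sum has at 0.\<close>
  define b where "b = 2 * rayleigh_sum 0 / (1 - \<alpha>)"
  have "b > 0" using assms rayleigh_sum_pos[of 0] by (auto simp: b_def)
  have "\<exists>\<mu>\<ge>0. \<mu> \<le> b \<and> \<phi> \<mu> = 0"
  proof (rule IVT')
    show "\<phi> 0 \<le> 0" using rayleigh_sum_pos[of 0] by (simp add: \<phi>_def)
    have "(1 - \<alpha>) * b = 2 * rayleigh_sum 0" using assms by (simp add: b_def)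
    with \<open>b > 0\<close> show "0 \<le> \<phi> b" using rayleigh_sum_antimono[of 0 b]
      by (simp add: \<phi>_def)
    show "continuous_on {0..b} \<phi>"
      unfolding \<phi>_def
      by (intro continuous_intros continuous_on_subset[OF continuous_on_rayleigh_sum]) auto
  qed (use \<open>b > 0\<close> in auto)
  then obtain \<mu> where \<mu>: "\<mu> \<ge> 0" "\<phi> \<mu> = 0" by auto
  have "\<phi> 0 \<noteq> 0" using rayleigh_sum_pos[of 0] by (simp add: \<phi>_def)
  with \<mu> have "\<mu> > 0" by (cases "\<mu> = 0") auto
  show thesis
  proof (rule that[OF \<open>\<mu> > 0\<close>])
    fix \<nu> :: real assume "\<nu> > 0"
    have "(1 - \<alpha>) * \<nu> = 2 * rayleigh_sum \<nu> \<longleftrightarrow> \<phi> \<nu> = \<phi> \<mu>"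
      and "2 * rayleigh_sum \<nu> \<le> (1 - \<alpha>) * \<nu> \<longleftrightarrow> \<phi> \<mu> \<le> \<phi> \<nu>"
      unfolding \<mu> by (simp_all add: \<phi>_def)
    then show "(1 - \<alpha>) * \<nu> = 2 * rayleigh_sum \<nu> \<longleftrightarrow> \<nu> = \<mu>"
      and "2 * rayleigh_sum \<nu> \<le> (1 - \<alpha>) * \<nu> \<longleftrightarrow> \<mu> \<le> \<nu>"
      using less[of \<mu> \<nu>] less[of \<nu> \<mu>] \<open>\<nu> > 0\<close> \<mu>(1)
      by (cases \<mu> \<nu> rule: linorder_cases; auto)+
  qed
qed

section \<open>The power series of the Bessel function\<close>

definition bessel_coeff :: "real \<Rightarrow> nat \<Rightarrow> real" where
  "bessel_coeff \<nu> n = (-1) ^ n / (4 ^ n * fact n * pochhammer (\<nu> + 1) n)"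

definition bessel_fps :: "real \<Rightarrow> complex fps" where
  "bessel_fps \<nu> = Abs_fps (\<lambda>n. of_real (bessel_coeff \<nu> n))"

lemma bessel_fps_nth [simp]: "fps_nth (bessel_fps \<nu>) n = of_real (bessel_coeff \<nu> n)"
  by (simp add: bessel_fps_def)

lemma bessel_coeff_0 [simp]: "bessel_coeff \<nu> 0 = 1"
  by (simp add: bessel_coeff_def)

text \<open>
  The two-term recurrence is Bessel's equation on the level of coefficients.
\<close>

lemma bessel_coeff_Suc:
  assumes "\<nu> > -1"
  shows "bessel_coeff \<nu> (Suc n) = - bessel_coeff \<nu> n / (4 * ((real n + 1) * (real n + 1 + \<nu>)))"
  using assms pochhammer_pos[of "\<nu> + 1" n]
  by (simp add: bessel_coeff_def pochhammer_Suc field_simps)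

lemma bessel_coeff_nonzero: "\<nu> > -1 \<Longrightarrow> bessel_coeff \<nu> n \<noteq> 0"
  using pochhammer_pos[of "\<nu> + 1" n] by (simp add: bessel_coeff_def)

lemma abs_bessel_coeff_le:
  assumes "\<nu> \<ge> 0"
  shows "\<bar>bessel_coeff \<nu> n\<bar> \<le> (1 / 4) ^ n"
proof (induction n)
  case (Suc n)
  have "1 \<le> (real n + 1) * (real n + 1 + \<nu>)"
    using assms mult_mono[of 1 "real n + 1" 1 "real n + 1 + \<nu>"] by simp
  then have "\<bar>bessel_coeff \<nu> n\<bar> / (4 * ((real n + 1) * (real n + 1 + \<nu>))) \<le> (1 / 4) ^ n / 4"
    using Suc by (intro frac_le) auto
  then show ?case using assms by (simp add: bessel_coeff_Suc abs_mult)
qed simp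

lemma fps_conv_radius_bessel:
  assumes "\<nu> > -1"
  shows "fps_conv_radius (bessel_fps \<nu>) = \<infinity>"
  unfolding fps_conv_radius_def
proof (rule conv_radius_ratio_limit_ereal)
  let ?b = "fps_nth (bessel_fps \<nu>)"
  have "norm (?b n) / norm (?b (Suc n)) = 4 * (real n + 1) * (real n + 1 + \<nu>)" for n
    unfolding bessel_fps_nth norm_of_real
    using assms bessel_coeff_nonzero[OF assms, of n]
    by (simp add: bessel_coeff_Suc abs_mult)
  moreover have "filterlim (\<lambda>n. 4 * (real n + 1) * (real n + 1 + \<nu>)) at_top sequentially"
    by real_asymp
  ultimately show "(\<lambda>n. ereal (norm (?b n) / norm (?b (Suc n)))) \<longlonglongrightarrow> \<infinity>"
    by (simp add: tendsto_PInfty_eq_at_top)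
qed (use assms in \<open>simp add: bessel_coeff_nonzero\<close>)

text \<open>
  The Euler operator \<open>X d/dX\<close> is diagonal on coefficients, so differential equations written in
  terms of it are recurrences for the coefficients.
\<close>

lemma fps_nth_euler: "fps_nth (fps_X * fps_deriv F) n = of_nat n * fps_nth F n"
  for F :: "'a :: comm_ring_1 fps"
  by (cases n) simp_all

lemma bessel_fps_ode:
  assumes "\<nu> > -1"
  defines "G \<equiv> bessel_fps \<nu>"
  shows "fps_X * fps_deriv (fps_X * fps_deriv G) + fps_const (of_real \<nu>) * (fps_X * fps_deriv G)
    + fps_const (1 / 4) * (fps_X * G) = 0"
    (is "?lhs = 0")
proof (rule fps_ext)
  fix n
  have nth: "fps_nth ?lhs n = of_real (real n * (real n + \<nu>) * bessel_coeff \<nu> n) + fps_nth (fps_X * G) n / 4"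
    by (simp only: fps_add_nth fps_nth_euler fps_mult_left_const_nth)
       (simp add: G_def algebra_simps del: fps_X_mult_nth)
  show "fps_nth ?lhs n = fps_nth 0 n"
  proof (cases n)
    case (Suc m)
    have "real n * (real n + \<nu>) * bessel_coeff \<nu> n = - bessel_coeff \<nu> m / 4"
    proof -
      have "p * q * (- b / (4 * (p * q))) = - b / 4" if "p \<noteq> 0" "q \<noteq> 0" for p q b :: real
        using that by simp
      from this[of "real m + 1" "real m + 1 + \<nu>"] show ?thesis
        using assms(1) by (simp add: Suc bessel_coeff_Suc add_ac)
    qed
    then show ?thesis unfolding nth by (simp add: Suc G_def)
  qed (simp add: nth)
qed

section \<open>The logarithmic derivative as a power series\<close>

definition rayleigh_fps :: "real \<Rightarrow> complex fps" where
  "rayleigh_fps \<nu> = Abs_fps (\<lambda>n. of_real (rayleigh \<nu> n))"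

lemma rayleigh_fps_nth [simp]: "fps_nth (rayleigh_fps \<nu>) n = of_real (rayleigh \<nu> n)"
  by (simp add: rayleigh_fps_def)

lemma rayleigh_fps_riccati:
  assumes "\<nu> > -1"
  defines "L \<equiv> rayleigh_fps \<nu>"
  shows "fps_X * fps_deriv L + fps_const (of_real \<nu>) * L = L * L + fps_const (1 / 4) * fps_X"
proof (rule fps_ext)
  fix n
  have "fps_nth (fps_X * fps_deriv L + fps_const (of_real \<nu>) * L) n =
        of_real ((real n + \<nu>) * rayleigh \<nu> n)"
    by (simp add: fps_nth_euler L_def algebra_simps del: fps_X_mult_nth)
  also have "\<dots> = fps_nth (L * L + fps_const (1 / 4) * fps_X) n"
    by (subst rayleigh_convolution[OF assms(1)]) (simp add: fps_mult_nth[of "rayleigh_fps \<nu>" "rayleigh_fps \<nu>"] L_def fps_X_def)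
  finally show "fps_nth (fps_X * fps_deriv L + fps_const (of_real \<nu>) * L) n =
    fps_nth (L * L + fps_const (1 / 4) * fps_X) n" .
qed

text \<open>
  The coefficient of index \<open>n\<close> is multiplied by \<open>n + \<nu>\<close>, which does not vanish for
  \<open>n \<ge> 1\<close>, and is determined by the lower ones because \<open>L\<close> has no constant term.
\<close>

lemma fps_euler_ode_zero:
  fixes D L :: "complex fps" and \<nu> :: real
  assumes "\<nu> > -1" "fps_nth D 0 = 0" "fps_nth L 0 = 0"
    and ode: "fps_X * fps_deriv D = (L - fps_const (of_real \<nu>)) * D"
  shows "D = 0"
proof (rule fps_ext)
  fix n
  show "fps_nth D n = fps_nth 0 n"
  proof (induction n rule: less_induct)
    case (less n)
    show ?case
    proof (cases "n = 0")
      case False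
      have "of_nat n * fps_nth D n = fps_nth (fps_X * fps_deriv D) n"
        by (rule fps_nth_euler[symmetric])
      also have "\<dots> = fps_nth (L * D) n - of_real \<nu> * fps_nth D n"
        unfolding ode by (simp add: left_diff_distrib)
      also have "fps_nth (L * D) n = 0"
        unfolding fps_mult_nth
      proof (rule sum.neutral, rule ballI)
        fix i assume "i \<in> {0..n}"
        with False assms(3) less[of "n - i"] show "fps_nth L i * fps_nth D (n - i) = 0"
          by (cases "i = 0") auto
      qed
      finally have "of_real (real n + \<nu>) * fps_nth D n = 0"
        by (simp add: algebra_simps)
      moreover have "complex_of_real (real n + \<nu>) \<noteq> 0"
        using False assms(1) unfolding of_real_eq_0_iff by simp
      ultimately show ?thesis by simp
    qed (use assms(2) in simp)
  qed
qed

text \<open>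
  Instead of dividing by \<open>G\<close>, consider the defect \<open>D = L G + X G'\<close>. Bessel's equation for
  \<open>G\<close> and the Riccati equation for \<open>L\<close> combine to \<open>X D' = (L - \<nu>) D\<close>, whose only solution
  without constant term is 0.
\<close>

lemma bessel_fps_log_deriv:
  assumes "\<nu> > -1"
  shows "fps_X * fps_deriv (bessel_fps \<nu>) = - (rayleigh_fps \<nu> * bessel_fps \<nu>)"
proof -
  define G L N where "G = bessel_fps \<nu>" and "L = rayleigh_fps \<nu>" and "N = fps_const (complex_of_real \<nu>)"
  define E D where "E = fps_X * fps_deriv G" and "D = L * G + E"
  have ode: "fps_X * fps_deriv E = - (N * E) - fps_const (1 / 4) * (fps_X * G)"
    using bessel_fps_ode[OF assms] unfolding G_def [symmetric] N_def [symmetric] E_def [symmetric]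
    by (simp add: algebra_simps add_eq_0_iff)
  have ric: "fps_X * fps_deriv L = L * L + fps_const (1 / 4) * fps_X - N * L"
    using rayleigh_fps_riccati[OF assms] unfolding L_def [symmetric] N_def [symmetric]
    by (simp add: algebra_simps)
  have "fps_X * fps_deriv D = (fps_X * fps_deriv L) * G + L * E + fps_X * fps_deriv E"
    by (simp add: D_def E_def algebra_simps)
  also have "\<dots> = (L - N) * D"
    unfolding ode ric by (simp add: D_def algebra_simps)
  finally have "D = 0"
    unfolding N_def
    by (intro fps_euler_ode_zero[OF assms, of D L]) (auto simp: D_def E_def L_def)
  then show ?thesis by (simp add: D_def E_def L_def G_def add_eq_0_iff)
qed

section \<open>Estimates in the disk\<close>

lemma rayleigh_fps_conv_radius:
  assumes "\<nu> \<ge> 0"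
  shows "fps_conv_radius (rayleigh_fps \<nu>) \<ge> 4"
  unfolding fps_conv_radius_def
proof (rule conv_radius_geI_ex')
  fix r :: real assume r: "0 < r" "ereal r < 4"
  show "summable (\<lambda>n. fps_nth (rayleigh_fps \<nu>) n * of_real r ^ n)"
  proof (rule summable_comparison_test'[of "\<lambda>n. (r / 4) ^ n" 0])
    show "norm (fps_nth (rayleigh_fps \<nu>) n * of_real r ^ n) \<le> (r / 4) ^ n" for n
      using r mult_right_mono[OF rayleigh_le_quarter_power[OF assms, of n], of "r ^ n"]
      by (simp add: norm_mult norm_power rayleigh_nonneg[OF assms] power_divide)
  qed (use r in simp)
qed

lemma rayleigh_fps_eval_1:
  assumes "\<nu> \<ge> 0"
  shows "eval_fps (rayleigh_fps \<nu>) 1 = of_real (rayleigh_sum \<nu>)"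
  using summable_rayleigh[OF assms] by (simp add: eval_fps_def rayleigh_sum_def suminf_of_real)

lemma bessel_eval_log_deriv:
  assumes "\<nu> \<ge> 0" "norm w < 4"
  shows "w * eval_fps (fps_deriv (bessel_fps \<nu>)) w =
         - (eval_fps (rayleigh_fps \<nu>) w * eval_fps (bessel_fps \<nu>) w)"
proof -
  have G: "fps_conv_radius (bessel_fps \<nu>) = \<infinity>" using assms by (intro fps_conv_radius_bessel) auto
  then have G': "fps_conv_radius (fps_deriv (bessel_fps \<nu>)) = \<infinity>"
    using fps_conv_radius_deriv[of "bessel_fps \<nu>"] by simp
  have L: "norm w < fps_conv_radius (rayleigh_fps \<nu>)"
    by (rule less_le_trans[OF _ rayleigh_fps_conv_radius[OF assms(1)]]) (use assms in simp)
  have LG: "norm w < fps_conv_radius (rayleigh_fps \<nu> * bessel_fps \<nu>)"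
    by (rule less_le_trans[OF _ fps_conv_radius_mult]) (use G L in simp)
  have "w * eval_fps (fps_deriv (bessel_fps \<nu>)) w = eval_fps (fps_X * fps_deriv (bessel_fps \<nu>)) w"
    using G' by (subst eval_fps_mult) auto
  also have "\<dots> = - (eval_fps (rayleigh_fps \<nu>) w * eval_fps (bessel_fps \<nu>) w)"
    using assms G L LG by (simp add: bessel_fps_log_deriv eval_fps_minus eval_fps_mult)
  finally show ?thesis .
qed

text \<open>
  The coefficients are dominated by \<open>4\<^sup>-\<^sup>n\<close>, so \<open>G\<close> differs from 1 by at most 1/3 on the closed
  unit disk. In particular \<open>h\<close> has no zeros in the disk and its principal powers are analytic there.
\<close>

lemma bessel_eval_Re_pos:
  assumes "\<nu> \<ge> 0" "norm w \<le> 1"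
  shows "Re (eval_fps (bessel_fps \<nu>) w) > 0"
proof -
  let ?t = "\<lambda>n. of_real (bessel_coeff \<nu> n) * w ^ n"
  have le: "norm (?t n) \<le> (1 / 4) ^ n" for n
  proof -
    have "norm (?t n) \<le> (1 / 4) ^ n * 1"
      unfolding norm_mult norm_power norm_of_real
      using assms by (intro mult_mono abs_bessel_coeff_le power_le_one) auto
    then show ?thesis by simp
  qed
  have "?t sums eval_fps (bessel_fps \<nu>) w"
    using sums_eval_fps[of w "bessel_fps \<nu>"] assms fps_conv_radius_bessel[of \<nu>] by simp
  then have tl: "(\<lambda>n. ?t (Suc n)) sums (eval_fps (bessel_fps \<nu>) w - 1)"
    by (subst sums_Suc_iff) simp
  have gs: "(\<lambda>n. (1 / 4 :: real) ^ Suc n) sums (1 / 3)"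
    using sums_mult[OF geometric_sums[of "1 / 4 :: real"], of "1 / 4"] by simp
  have "norm (eval_fps (bessel_fps \<nu>) w - 1) \<le> 1 / 3"
    unfolding sums_unique[OF tl] sums_unique[OF gs]
    by (rule norm_suminf_le[OF le]) (use gs in \<open>simp add: sums_iff\<close>)
  then have "\<bar>Re (eval_fps (bessel_fps \<nu>) w - 1)\<bar> \<le> 1 / 3"
    using abs_Re_le_cmod order_trans by blast
  then have "\<bar>Re (eval_fps (bessel_fps \<nu>) w) - 1\<bar> \<le> 1 / 3" by (simp only: minus_complex.sel one_complex.sel)
  then show ?thesis by linarith
qed

text \<open>
  Nonnegative coefficients place the maximum modulus on the positive axis; strictness comes from the
  missing constant term, which leaves a factor \<open>norm w\<close> in every summand.
\<close>

lemma Re_rayleigh_eval_less: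
  assumes "\<nu> \<ge> 0" "norm w < 1"
  shows "Re (eval_fps (rayleigh_fps \<nu>) w) < rayleigh_sum \<nu>"
proof -
  have "norm (eval_fps (rayleigh_fps \<nu>) w) \<le> (\<Sum>n. norm w * rayleigh \<nu> n)"
    unfolding eval_fps_def
  proof (rule norm_suminf_le)
    show "norm (fps_nth (rayleigh_fps \<nu>) n * w ^ n) \<le> norm w * rayleigh \<nu> n" for n
    proof (cases n)
      case (Suc m)
      have "rayleigh \<nu> n * norm w ^ n \<le> rayleigh \<nu> n * norm w"
        using assms Suc by (intro mult_left_mono rayleigh_nonneg) (auto simp: power_le_one mult_left_le)
      then show ?thesis by (simp add: norm_mult norm_power rayleigh_nonneg[OF assms(1)] mult.commute)
    qed simp
  qed (intro summable_mult summable_rayleigh assms)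
  also have "\<dots> = norm w * rayleigh_sum \<nu>"
    unfolding rayleigh_sum_def by (intro suminf_mult summable_rayleigh assms)
  also have "\<dots> < rayleigh_sum \<nu>"
    using assms rayleigh_sum_pos[of \<nu>] by simp
  finally show ?thesis using complex_Re_le_cmod[of "eval_fps (rayleigh_fps \<nu>) w"] by linarith
qed

text \<open>
  The bound of the previous lemma is sharp. The variable is squared because \<open>L\<close> will be
  evaluated at \<open>z\<^sup>2\<close>.
\<close>

lemma Re_rayleigh_eval_tendsto:
  assumes "\<nu> \<ge> 0"
  shows "((\<lambda>t. Re (eval_fps (rayleigh_fps \<nu>) (of_real (t\<^sup>2)))) \<longlongrightarrow> rayleigh_sum \<nu>) (at_left 1)"
proof -
  have "1 < fps_conv_radius (rayleigh_fps \<nu>)"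
    by (rule less_le_trans[OF _ rayleigh_fps_conv_radius[OF assms]]) simp
  then have "isCont (eval_fps (rayleigh_fps \<nu>)) (of_real (1\<^sup>2))"
    by (intro continuous_intros) (simp add: one_ereal_def)
  moreover have "((\<lambda>t::real. complex_of_real (t\<^sup>2)) \<longlongrightarrow> of_real (1\<^sup>2)) (at_left 1)"
    by (intro tendsto_intros)
  ultimately have "((\<lambda>t::real. eval_fps (rayleigh_fps \<nu>) (of_real (t\<^sup>2))) \<longlongrightarrow>
      eval_fps (rayleigh_fps \<nu>) (of_real (1\<^sup>2))) (at_left 1)"
    by (rule isCont_tendsto_compose)
  from tendsto_Re[OF this] show ?thesis by (simp add: rayleigh_fps_eval_1[OF assms])
qed

section \<open>From the power series to the Bessel function\<close>

lemma pos_real_notin_nonpos_Ints: "x > 0 \<Longrightarrow> complex_of_real x \<notin> \<int>\<^sub>\<le>\<^sub>0"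
  unfolding of_real_in_nonpos_Ints_iff by (auto dest: nonpos_Ints_nonpos)

lemma Gamma_of_real_nonzero: "x > 0 \<Longrightarrow> Gamma (complex_of_real x) \<noteq> 0"
  using pos_real_notin_nonpos_Ints by (simp add: Gamma_eq_zero_iff)

lemma bessel_J_eq:
  assumes "\<nu> > -1" "z \<noteq> 0"
  shows "bessel_J \<nu> z =
    (z / 2) powr of_real \<nu> / Gamma (of_real (\<nu> + 1)) * eval_fps (bessel_fps \<nu>) (z\<^sup>2)"
proof -
  let ?c = "(z / 2) powr of_real \<nu> / Gamma (of_real (\<nu> + 1))"
  have nonpos: "complex_of_real (\<nu> + 1) \<notin> \<int>\<^sub>\<le>\<^sub>0"
    by (rule pos_real_notin_nonpos_Ints) (use assms(1) in simp)
  have summand: "(-1) ^ n / (fact n * Gamma (of_real (real n + \<nu> + 1))) * (z / 2) powr of_real (2 * real n + \<nu>)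
        = ?c * (fps_nth (bessel_fps \<nu>) n * (z\<^sup>2) ^ n)" for n
  proof -
    have "pochhammer (complex_of_real (\<nu> + 1)) n =
          Gamma (complex_of_real (\<nu> + 1) + of_nat n) / Gamma (complex_of_real (\<nu> + 1))"
      by (rule pochhammer_Gamma[OF nonpos])
    then have G: "Gamma (complex_of_real (real n + \<nu> + 1)) =
          of_real (pochhammer (\<nu> + 1) n) * Gamma (complex_of_real (\<nu> + 1))"
      using nonpos by (simp add: Gamma_eq_zero_iff add_ac flip: pochhammer_of_real)
    have "(z / 2) powr of_real (2 * real n + \<nu>) = (z / 2) powr of_nat (2 * n) * (z / 2) powr of_real \<nu>"
      by (simp add: powr_add)
    also have "(z / 2) powr of_nat (2 * n) = (z / 2) ^ (2 * n)"
      using assms(2) by (subst powr_nat') auto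
    also have "\<dots> = (z\<^sup>2) ^ n / 4 ^ n"
      by (simp add: power_mult power_divide)
    finally show ?thesis
      unfolding G bessel_coeff_def bessel_fps_nth by (simp add: mult_ac)
  qed
  have "(\<lambda>n. fps_nth (bessel_fps \<nu>) n * (z\<^sup>2) ^ n) sums eval_fps (bessel_fps \<nu>) (z\<^sup>2)"
    using assms by (intro sums_eval_fps) (simp add: fps_conv_radius_bessel)
  then show ?thesis
    unfolding bessel_J_def summand by (intro sums_unique[symmetric] sums_mult)
qed

lemma bessel_h_eq:
  assumes "\<nu> > -1"
  shows "bessel_h \<nu> z = eval_fps (bessel_fps \<nu>) (z\<^sup>2)"
proof (cases "z = 0")
  case False
  have "Ln (z / 2) = Ln z - of_real (ln 2)"
    using False Ln_divide_of_real[of 2 z] by simp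
  then have "of_real \<nu> * of_real (ln 2) + - of_real \<nu> * Ln z + of_real \<nu> * Ln (z / 2) = 0"
    by (simp only: right_diff_distrib) simp
  moreover have "Ln 2 = complex_of_real (ln 2)" using Ln_of_real[of 2] by simp
  ultimately have "2 powr of_real \<nu> * z powr (- of_real \<nu>) * (z / 2) powr of_real \<nu> = (1 :: complex)"
    using False by (simp add: powr_def flip: exp_add)
  moreover have "Gamma (complex_of_real (\<nu> + 1)) \<noteq> 0"
    by (rule Gamma_of_real_nonzero) (use assms in simp)
  ultimately show ?thesis
    using False assms by (simp add: bessel_h_def bessel_J_eq field_simps)
qed (simp add: bessel_h_def eval_fps_at_0)

lemma bessel_fps_deriv:
  assumes "\<nu> > -1"
  shows "fps_deriv (bessel_fps \<nu>) = fps_const (- 1 / (4 * of_real (\<nu> + 1))) * bessel_fps (\<nu> + 1)"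
proof (rule fps_ext)
  fix n
  have *: "real (Suc n) * bessel_coeff \<nu> (Suc n) = - 1 / (4 * (\<nu> + 1)) * bessel_coeff (\<nu> + 1) n"
  proof -
    have "s * (- m / (4 * q * (s * t) * (v * P))) = - 1 / (4 * v) * (m / (q * t * P))"
      if "s \<noteq> 0" for s m q t v P :: real
      using that by simp
    from this[of "real (Suc n)" "(-1) ^ n" "4 ^ n" "fact n" "\<nu> + 1" "pochhammer (\<nu> + 2) n"]
    show ?thesis by (simp add: bessel_coeff_def pochhammer_rec del: of_nat_Suc)
  qed
  show "fps_nth (fps_deriv (bessel_fps \<nu>)) n =
        fps_nth (fps_const (- 1 / (4 * of_real (\<nu> + 1))) * bessel_fps (\<nu> + 1)) n"
    using arg_cong[OF *, of complex_of_real] by simp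
qed

text \<open>
  Differentiating the series raises the order: \<open>G\<^sub>\<nu>' = - G\<^bsub>\<nu>+1\<^esub> / (4 (\<nu>+1))\<close>. At \<open>w = 1\<close>
  this turns the quotient of Bessel values into \<open>-2 G'(1) / G(1)\<close>.
\<close>

lemma bessel_J_ratio:
  assumes "\<nu> \<ge> 0"
  shows "bessel_J (\<nu> + 1) 1 = of_real (2 * rayleigh_sum \<nu>) * bessel_J \<nu> 1"
proof -
  have G: "Gamma (complex_of_real (\<nu> + 1 + 1)) = of_real (\<nu> + 1) * Gamma (of_real (\<nu> + 1))"
    using Gamma_plus1[OF pos_real_notin_nonpos_Ints[of "\<nu> + 1"]] assms by simp
  define c where "c = complex_of_real (\<nu> + 1)"
  have "c \<noteq> 0" unfolding c_def of_real_eq_0_iff using assms by simp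
  have "eval_fps (fps_deriv (bessel_fps \<nu>)) 1 = - 1 / (4 * c) * eval_fps (bessel_fps (\<nu> + 1)) 1"
    using assms unfolding c_def by (subst bessel_fps_deriv) (simp_all add: eval_fps_mult fps_conv_radius_bessel)
  moreover have "eval_fps (fps_deriv (bessel_fps \<nu>)) 1 =
        - (of_real (rayleigh_sum \<nu>) * eval_fps (bessel_fps \<nu>) 1)"
    using bessel_eval_log_deriv[of \<nu> 1] assms by (simp add: rayleigh_fps_eval_1)
  ultimately have "- 1 / (4 * c) * eval_fps (bessel_fps (\<nu> + 1)) 1 =
        - (of_real (rayleigh_sum \<nu>) * eval_fps (bessel_fps \<nu>) 1)"
    by (rule trans[OF sym])
  then have "eval_fps (bessel_fps (\<nu> + 1)) 1 =
      4 * c * (of_real (rayleigh_sum \<nu>) * eval_fps (bessel_fps \<nu>) 1)"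
    using \<open>c \<noteq> 0\<close> by (simp add: field_simps)
  moreover have "(1 / 2 :: complex) powr of_real \<nu> = 2 * (1 / 2) powr of_real (\<nu> + 1)"
    by (simp add: powr_add)
  moreover have "bessel_J \<nu> 1 = (1 / 2) powr of_real \<nu> / Gamma c * eval_fps (bessel_fps \<nu>) 1"
    using assms bessel_J_eq[of \<nu> 1] by (simp add: c_def)
  moreover have "bessel_J (\<nu> + 1) 1 = (1 / 2) powr of_real (\<nu> + 1) / Gamma (complex_of_real (\<nu> + 1 + 1))
      * eval_fps (bessel_fps (\<nu> + 1)) 1"
    using assms bessel_J_eq[of "\<nu> + 1" 1] by simp
  ultimately show ?thesis
    using \<open>c \<noteq> 0\<close> unfolding G c_def [symmetric] by simp
qed

lemma is_nu1_iff:
  "is_nu1 \<alpha> \<nu> \<longleftrightarrow> \<nu> > 0 \<and> (1 - \<alpha>) * \<nu> = 2 * rayleigh_sum \<nu>"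
proof (cases "\<nu> > 0")
  case True
  have "Re (eval_fps (bessel_fps \<nu>) 1) > 0"
    using True by (intro bessel_eval_Re_pos) auto
  moreover have "Gamma (complex_of_real (\<nu> + 1)) \<noteq> 0"
    by (rule Gamma_of_real_nonzero) (use True in simp)
  ultimately have "bessel_J \<nu> 1 \<noteq> 0"
    using True by (auto simp: bessel_J_eq simp del: of_real_add)
  then have "of_real ((1 - \<alpha>) * \<nu>) * bessel_J \<nu> 1 = of_real (2 * rayleigh_sum \<nu>) * bessel_J \<nu> 1
      \<longleftrightarrow> (1 - \<alpha>) * \<nu> = 2 * rayleigh_sum \<nu>"
    unfolding mult_cancel_right of_real_eq_iff by simp
  with True show ?thesis by (simp only: is_nu1_def bessel_J_ratio)
qed (simp add: is_nu1_def)

section \<open>The starlikeness quotient\<close>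

lemma has_derivative_bessel_square:
  assumes "\<nu> > -1"
  shows "((\<lambda>z. eval_fps (bessel_fps \<nu>) (z\<^sup>2)) has_field_derivative
           2 * z * eval_fps (fps_deriv (bessel_fps \<nu>)) (z\<^sup>2)) (at z)"
proof -
  have F: "(eval_fps (bessel_fps \<nu>) has_field_derivative eval_fps (fps_deriv (bessel_fps \<nu>)) (z\<^sup>2)) (at (z\<^sup>2))"
    by (rule has_field_derivative_eval_fps) (simp add: fps_conv_radius_bessel[OF assms])
  have "((\<lambda>z. z\<^sup>2) has_field_derivative 2 * z) (at z)"
    by (auto intro!: derivative_eq_intros)
  from DERIV_chain2[OF F this] show ?thesis by (simp only: mult.commute)
qed

text \<open>
  Near 0 the function is a principal power and can be differentiated directly. The resulting identity
  is stated without divisions, so both sides are analytic on the whole disk and the identity theorem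
  extends it there, whatever branch \<open>f\<close> has and wherever \<open>h\<close> vanishes.
\<close>

lemma bessel_f_log_deriv:
  assumes "\<nu> > -1" "\<nu> \<noteq> 0" "is_bessel_f \<nu> f" "z \<in> ball 0 1"
  shows "of_real \<nu> * (z * deriv f z - f z) * eval_fps (bessel_fps \<nu>) (z\<^sup>2) =
         2 * z\<^sup>2 * eval_fps (fps_deriv (bessel_fps \<nu>)) (z\<^sup>2) * f z"
proof -
  define H H' where "H = (\<lambda>z. eval_fps (bessel_fps \<nu>) (z\<^sup>2))"
    and "H' = (\<lambda>z. eval_fps (fps_deriv (bessel_fps \<nu>)) (z\<^sup>2))"
  have G: "fps_conv_radius (bessel_fps \<nu>) = \<infinity>" by (rule fps_conv_radius_bessel[OF assms(1)])
  then have G': "fps_conv_radius (fps_deriv (bessel_fps \<nu>)) = \<infinity>"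
    using fps_conv_radius_deriv[of "bessel_fps \<nu>"] by simp
  have dH: "(H has_field_derivative 2 * z * H' z) (at z)" for z
    unfolding H_def H'_def by (rule has_derivative_bessel_square[OF assms(1)])
  have holH: "H holomorphic_on A" "H' holomorphic_on A" for A
    unfolding H_def H'_def
    by (auto intro!: holomorphic_on_compose_gen[of "\<lambda>z. z\<^sup>2" _ "eval_fps _" UNIV, unfolded o_def]
          holomorphic_intros simp: G G')
  have holf: "f holomorphic_on ball 0 1"
    and evf: "\<forall>\<^sub>F z in nhds 0. f z = z * H z powr of_real (1 / \<nu>)"
    using assms(3) by (simp_all add: is_bessel_f_def bessel_h_eq[OF assms(1)] H_def)
  have "H 0 = 1" by (simp add: H_def eval_fps_at_0)
  have "continuous_on UNIV H" by (intro holomorphic_on_imp_continuous_on holH)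
  then have "open (H -` ball 1 1)" by (intro open_vimage) auto
  then have "\<forall>\<^sub>F z in nhds 0. z \<in> H -` ball 1 1"
    by (rule eventually_nhds_in_open) (simp add: \<open>H 0 = 1\<close>)
  moreover have "\<forall>\<^sub>F z in nhds (0::complex). z \<in> ball 0 1"
    by (rule eventually_nhds_in_open) auto
  ultimately have "\<forall>\<^sub>F z in nhds 0. f z = z * H z powr of_real (1 / \<nu>) \<and>
      z \<in> H -` ball 1 1 \<and> z \<in> ball 0 1"
    using evf by eventually_elim auto
  then obtain U where U: "open U" "0 \<in> U"
    and "\<forall>z\<in>U. f z = z * H z powr of_real (1 / \<nu>) \<and> z \<in> H -` ball 1 1 \<and> z \<in> ball 0 1"
    unfolding eventually_nhds by blast
  then have fU: "\<And>z. z \<in> U \<Longrightarrow> f z = z * H z powr of_real (1 / \<nu>)"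
    and HU: "\<And>z. z \<in> U \<Longrightarrow> H z \<in> ball 1 1" and U1: "U \<subseteq> ball 0 1"
    by blast+
  have "of_real \<nu> * (z * deriv f z - f z) * H z = 2 * z\<^sup>2 * H' z * f z"
  proof (rule analytic_continuation_open[of U "ball 0 1"
        "\<lambda>z. of_real \<nu> * (z * deriv f z - f z) * H z" "\<lambda>z. 2 * z\<^sup>2 * H' z * f z"])
    fix z assume z: "z \<in> U"
    define c where "c = complex_of_real (1 / \<nu>)"
    have "\<bar>Re (1 - H z)\<bar> < 1"
      using HU[OF z] abs_Re_le_cmod[of "1 - H z"] by (simp add: dist_norm)
    then have "Re (H z) > 0" by simp
    then have np: "H z \<notin> \<real>\<^sub>\<le>\<^sub>0" by (auto simp: complex_nonpos_Reals_iff)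
    then have nz: "H z \<noteq> 0" by auto
    have "((\<lambda>z. z * H z powr c) has_field_derivative
        (H z powr c + z * (c * H z powr (c - 1) * (2 * z * H' z)))) (at z)"
      using np by (auto intro!: derivative_eq_intros dH)
    then have "(f has_field_derivative
        (H z powr c + z * (c * H z powr (c - 1) * (2 * z * H' z)))) (at z)"
      by (rule has_field_derivative_transform_within_open[OF _ U(1) z]) (simp add: fU c_def)
    then have d: "deriv f z = H z powr c + z * (c * H z powr (c - 1) * (2 * z * H' z))"
      by (rule DERIV_imp_deriv)
    have p: "H z powr c = H z powr (c - 1) * H z"
      using nz powr_add[of "H z" "c - 1" 1] by simp
    have "of_real \<nu> * c = 1" using assms(2) by (simp add: c_def)
    then have "of_real \<nu> * (z * deriv f z - z * H z powr c) * H z = 2 * z\<^sup>2 * H' z * (z * H z powr c)"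
      unfolding d p by (simp add: algebra_simps power2_eq_square)
    then show "of_real \<nu> * (z * deriv f z - f z) * H z = 2 * z\<^sup>2 * H' z * f z"
      using fU[OF z] by (simp add: c_def)
  qed (use U U1 assms(4) in \<open>auto intro!: holomorphic_intros holf holH\<close>)
  then show ?thesis by (simp add: H_def H'_def)
qed

lemma bessel_f_starlike_quotient:
  assumes "\<nu> > -1" "\<nu> \<noteq> 0" "is_bessel_f \<nu> f" "z \<in> ball 0 1" "f z \<noteq> 0"
    "eval_fps (bessel_fps \<nu>) (z\<^sup>2) \<noteq> 0"
  shows "z * deriv f z / f z = 1 + 2 / of_real \<nu> *
    (z\<^sup>2 * eval_fps (fps_deriv (bessel_fps \<nu>)) (z\<^sup>2) / eval_fps (bessel_fps \<nu>) (z\<^sup>2))"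
  using bessel_f_log_deriv[OF assms(1-4)] assms(2,5,6)
  by (simp add: field_simps)

lemma bessel_f_starlike_quotient_rayleigh:
  assumes "\<nu> > 0" "is_bessel_f \<nu> f" "z \<in> ball 0 1" "f z \<noteq> 0"
  shows "z * deriv f z / f z = 1 - 2 / of_real \<nu> * eval_fps (rayleigh_fps \<nu>) (z\<^sup>2)"
proof -
  have z: "norm (z\<^sup>2) \<le> 1" using assms(3) by (simp add: norm_power power_le_one)
  have "Re (eval_fps (bessel_fps \<nu>) (z\<^sup>2)) > 0"
    using assms(1) z by (intro bessel_eval_Re_pos) auto
  then have nz: "eval_fps (bessel_fps \<nu>) (z\<^sup>2) \<noteq> 0" by auto
  have "z * deriv f z / f z = 1 + 2 / of_real \<nu> *
    (z\<^sup>2 * eval_fps (fps_deriv (bessel_fps \<nu>)) (z\<^sup>2) / eval_fps (bessel_fps \<nu>) (z\<^sup>2))"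
    using assms nz by (intro bessel_f_starlike_quotient) auto
  also have "z\<^sup>2 * eval_fps (fps_deriv (bessel_fps \<nu>)) (z\<^sup>2) =
      - (eval_fps (rayleigh_fps \<nu>) (z\<^sup>2) * eval_fps (bessel_fps \<nu>) (z\<^sup>2))"
    using assms(1) z by (intro bessel_eval_log_deriv) auto
  finally show ?thesis using nz by simp
qed

section \<open>Starlikeness for positive and for negative order\<close>

lemma is_bessel_f_principal:
  assumes "\<nu> > 0"
  defines "f \<equiv> \<lambda>z. z * bessel_h \<nu> z powr of_real (1 / \<nu>)"
  shows "is_bessel_f \<nu> f" "f 0 = 0" "deriv f 0 = 1" "\<And>z. z \<in> ball 0 1 - {0} \<Longrightarrow> f z \<noteq> 0"
proof -
  define H where "H = (\<lambda>z. eval_fps (bessel_fps \<nu>) (z\<^sup>2))"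
  have f: "f = (\<lambda>z. z * H z powr of_real (1 / \<nu>))"
    using assms(1) by (simp add: f_def H_def bessel_h_eq)
  have dH: "(H has_field_derivative 2 * z * eval_fps (fps_deriv (bessel_fps \<nu>)) (z\<^sup>2)) (at z)" for z
    unfolding H_def using assms(1) by (intro has_derivative_bessel_square) auto
  have Hp: "H z \<notin> \<real>\<^sub>\<le>\<^sub>0" if "z \<in> ball 0 1" for z
  proof -
    have "Re (H z) > 0"
      unfolding H_def using that assms(1)
      by (intro bessel_eval_Re_pos) (auto simp: norm_power power_le_one)
    then show ?thesis by (auto simp: complex_nonpos_Reals_iff)
  qed
  have "H holomorphic_on ball 0 1"
    using dH by (auto simp: holomorphic_on_open)
  with Hp have "f holomorphic_on ball 0 1"
    unfolding f by (intro holomorphic_intros) auto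
  then show "is_bessel_f \<nu> f" by (simp add: is_bessel_f_def f_def)
  show "f 0 = 0" by (simp add: f)
  have H0: "H 0 = 1" by (simp add: H_def eval_fps_at_0)
  have "(f has_field_derivative 1) (at 0)"
    unfolding f using Hp[of 0] by (auto intro!: derivative_eq_intros dH simp: H0)
  then show "deriv f 0 = 1" by (rule DERIV_imp_deriv)
  show "f z \<noteq> 0" if "z \<in> ball 0 1 - {0}" for z
    using Hp[of z] that by (auto simp: f)
qed

lemma Re_one_minus: "Re (1 - 2 / of_real x * w) = 1 - 2 / x * Re w"
proof -
  have "2 / complex_of_real x = of_real (2 / x)" by simp
  then show ?thesis by (simp del: of_real_divide)
qed

text \<open>
  Sufficiency is the strict bound for \<open>Re L\<close>, applied to the principal branch. For necessity let
  \<open>z\<close> tend to 1 along the real axis: the strict inequality in the disk survives as a weak one.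
\<close>

lemma starlike_iff_pos:
  assumes "\<nu> > 0" "0 \<le> \<alpha>"
  shows "(\<exists>f. is_bessel_f \<nu> f \<and> starlike_of_order \<alpha> f) \<longleftrightarrow> 2 * rayleigh_sum \<nu> \<le> (1 - \<alpha>) * \<nu>"
proof
  assume "\<exists>f. is_bessel_f \<nu> f \<and> starlike_of_order \<alpha> f"
  then obtain f where f: "is_bessel_f \<nu> f" "starlike_of_order \<alpha> f" by blast
  let ?g = "\<lambda>t. Re (eval_fps (rayleigh_fps \<nu>) (of_real (t\<^sup>2)))"
  have bound: "?g t \<le> (1 - \<alpha>) * \<nu> / 2" if "t \<in> {0<..<1}" for t
  proof -
    have t: "complex_of_real t \<in> ball 0 1 - {0}" using that by auto
    with f(2) have gt: "Re (of_real t * deriv f (of_real t) / f (of_real t)) > \<alpha>"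
      unfolding starlike_of_order_def by blast
    with assms(2) have "f (of_real t) \<noteq> 0" by auto
    with gt t f(1) assms(1) have "Re (1 - 2 / of_real \<nu> * eval_fps (rayleigh_fps \<nu>) (of_real (t\<^sup>2))) > \<alpha>"
      using bessel_f_starlike_quotient_rayleigh[of \<nu> f "of_real t"] by simp
    then have "1 - 2 / \<nu> * ?g t > \<alpha>"
      by (simp only: Re_one_minus)
    then show ?thesis using assms(1) by (simp add: field_simps)
  qed
  have "rayleigh_sum \<nu> \<le> (1 - \<alpha>) * \<nu> / 2"
  proof (rule tendsto_upperbound[OF Re_rayleigh_eval_tendsto])
    show "\<forall>\<^sub>F t in at_left 1. ?g t \<le> (1 - \<alpha>) * \<nu> / 2"
      using eventually_at_left_real[OF zero_less_one] by (rule eventually_mono) (rule bound, simp)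
  qed (use assms in auto)
  then show "2 * rayleigh_sum \<nu> \<le> (1 - \<alpha>) * \<nu>" by simp
next
  assume le: "2 * rayleigh_sum \<nu> \<le> (1 - \<alpha>) * \<nu>"
  define f where "f = (\<lambda>z. z * bessel_h \<nu> z powr of_real (1 / \<nu>))"
  note f = is_bessel_f_principal[OF assms(1), folded f_def]
  have "starlike_of_order \<alpha> f"
    unfolding starlike_of_order_def
  proof (intro conjI ballI)
    fix z :: complex assume z: "z \<in> ball 0 1 - {0}"
    then have "norm z ^ 2 < 1" by (simp add: power_less_one_iff)
    then have "Re (eval_fps (rayleigh_fps \<nu>) (z\<^sup>2)) < rayleigh_sum \<nu>"
      using assms(1) by (intro Re_rayleigh_eval_less) (auto simp: norm_power)
    with le have "2 * Re (eval_fps (rayleigh_fps \<nu>) (z\<^sup>2)) < (1 - \<alpha>) * \<nu>" by linarith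
    then have "1 - 2 / \<nu> * Re (eval_fps (rayleigh_fps \<nu>) (z\<^sup>2)) > \<alpha>"
      using assms(1) by (simp add: field_simps)
    then have "Re (1 - 2 / of_real \<nu> * eval_fps (rayleigh_fps \<nu>) (z\<^sup>2)) > \<alpha>"
      by (simp only: Re_one_minus)
    moreover have "z * deriv f z / f z = 1 - 2 / of_real \<nu> * eval_fps (rayleigh_fps \<nu>) (z\<^sup>2)"
      using z f(4)[OF z] by (intro bessel_f_starlike_quotient_rayleigh assms f(1)) (simp_all add: f_def)
    ultimately show "Re (z * deriv f z / f z) > \<alpha>" by simp
  qed (use f in \<open>auto simp: is_bessel_f_def f_def\<close>)
  with f(1) show "\<exists>f. is_bessel_f \<nu> f \<and> starlike_of_order \<alpha> f" by blast
qed

text \<open>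
  At \<open>z\<^sup>2 = -x\<close> with \<open>x > 0\<close> the series of \<open>G\<close> has the positive terms \<open>\<beta>\<^sub>n\<close>, so the
  quotient is negative as soon as \<open>\<nu> G + 2 w G' = \<Sum>n. (\<nu> + 2n) \<beta>\<^sub>n\<close> is positive. Only the
  term \<open>n = 0\<close> is negative, and the term \<open>n = 1\<close> outweighs it if
  \<open>4 \<nu> (\<nu>+1) + (\<nu>+2) x > 0\<close>. As a quadratic in \<open>\<nu>\<close> this has discriminant
  \<open>(4 + x)\<^sup>2 - 32 x\<close>, which is negative for \<open>x\<close> close to 1.
\<close>

lemma not_starlike_neg:
  assumes "-1 < \<nu>" "\<nu> < 0" "0 \<le> \<alpha>"
  shows "\<not> (is_bessel_f \<nu> f \<and> starlike_of_order \<alpha> f)"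
proof
  assume "is_bessel_f \<nu> f \<and> starlike_of_order \<alpha> f"
  then have f: "is_bessel_f \<nu> f" "starlike_of_order \<alpha> f" by auto
  \<comment> \<open>The square of 9/10: negative discriminant and a point inside the disk.\<close>
  define x :: real where "x = 81 / 100"
  define \<beta> where "\<beta> n = \<bar>bessel_coeff \<nu> n\<bar> * x ^ n" for n
  have G: "fps_conv_radius (bessel_fps \<nu>) = \<infinity>" by (rule fps_conv_radius_bessel[OF assms(1)])
  have summand: "bessel_coeff \<nu> n * (- x) ^ n = \<beta> n" for n
  proof -
    have "bessel_coeff \<nu> n * (-1) ^ n = \<bar>bessel_coeff \<nu> n\<bar>"
      using assms(1) pochhammer_pos[of "\<nu> + 1" n]
      by (simp add: bessel_coeff_def abs_mult power_abs flip: power_add)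
    then show ?thesis unfolding \<beta>_def power_minus[of x] by (simp flip: mult.assoc)
  qed
  have \<beta>_nonneg: "\<beta> n \<ge> 0" for n by (simp add: \<beta>_def x_def)
  let ?w = "complex_of_real (- x)"
  have term_of_real: "complex_of_real (bessel_coeff \<nu> n) * ?w ^ n = of_real (\<beta> n)" for n
    by (simp only: of_real_mult of_real_power flip: summand)
  have "(\<lambda>n. fps_nth (bessel_fps \<nu>) n * ?w ^ n) sums eval_fps (bessel_fps \<nu>) ?w"
    by (intro sums_eval_fps) (simp add: G)
  then have A': "(\<lambda>n. complex_of_real (\<beta> n)) sums eval_fps (bessel_fps \<nu>) ?w"
    unfolding bessel_fps_nth term_of_real .
  have G': "fps_conv_radius (fps_deriv (bessel_fps \<nu>)) = \<infinity>"
    using G fps_conv_radius_deriv[of "bessel_fps \<nu>"] by simp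
  then have XG': "fps_conv_radius (fps_X * fps_deriv (bessel_fps \<nu>)) = \<infinity>"
    using fps_conv_radius_mult[of fps_X "fps_deriv (bessel_fps \<nu>)"] by simp
  have "(\<lambda>n. fps_nth (fps_X * fps_deriv (bessel_fps \<nu>)) n * ?w ^ n) sums
          eval_fps (fps_X * fps_deriv (bessel_fps \<nu>)) ?w"
    by (intro sums_eval_fps, subst XG') simp
  also have "eval_fps (fps_X * fps_deriv (bessel_fps \<nu>)) ?w = ?w * eval_fps (fps_deriv (bessel_fps \<nu>)) ?w"
    by (subst eval_fps_mult) (simp_all add: G')
  also have "(\<lambda>n. fps_nth (fps_X * fps_deriv (bessel_fps \<nu>)) n * ?w ^ n) =
      (\<lambda>n. complex_of_real (real n * \<beta> n))"
    unfolding fps_nth_euler bessel_fps_nth mult.assoc term_of_real by simp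
  finally have B': "(\<lambda>n. complex_of_real (real n * \<beta> n)) sums
      (?w * eval_fps (fps_deriv (bessel_fps \<nu>)) ?w)" .
  define A B where "A = (\<Sum>n. \<beta> n)" and "B = (\<Sum>n. real n * \<beta> n)"
  have A: "\<beta> sums A" and Aw: "eval_fps (bessel_fps \<nu>) ?w = of_real A"
    using A' sums_iff suminf_of_real summable_of_real_iff unfolding A_def by metis+
  have B: "(\<lambda>n. real n * \<beta> n) sums B" and Bw: "?w * eval_fps (fps_deriv (bessel_fps \<nu>)) ?w = of_real B"
    using B' sums_iff suminf_of_real summable_of_real_iff unfolding B_def by metis+
  have "(\<Sum>n\<in>{0}. \<beta> n) \<le> A"
    unfolding A_def using A by (intro sum_le_suminf) (auto simp: \<beta>_nonneg sums_iff)
  then have "A > 0" by (simp add: \<beta>_def)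
  have S: "(\<lambda>n. (\<nu> + 2 * real n) * \<beta> n) sums (\<nu> * A + 2 * B)"
    using sums_add[OF sums_mult[OF A, of \<nu>] sums_mult[OF B, of 2]] by (simp add: algebra_simps)
  have "(\<Sum>n\<in>{0, 1}. (\<nu> + 2 * real n) * \<beta> n) \<le> (\<Sum>n. (\<nu> + 2 * real n) * \<beta> n)"
  proof (rule sum_le_suminf)
    fix n :: nat assume "n \<in> - {0, 1}"
    then have "n \<ge> 2" by auto
    then show "0 \<le> (\<nu> + 2 * real n) * \<beta> n"
      using assms(1) by (intro mult_nonneg_nonneg \<beta>_nonneg) auto
  qed (use S in \<open>auto simp: sums_iff\<close>)
  also have "\<dots> = \<nu> * A + 2 * B" using S by (simp add: sums_iff)
  also have "(\<Sum>n\<in>{0, 1}. (\<nu> + 2 * real n) * \<beta> n) = (4 * \<nu> * (\<nu> + 1) + (\<nu> + 2) * x) / (4 * (\<nu> + 1))"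
  proof -
    have "\<beta> 0 = 1" "\<beta> 1 = x / (4 * (\<nu> + 1))"
      using assms(1) by (simp_all add: \<beta>_def bessel_coeff_Suc add.commute)
    moreover have "4 * \<nu> * (\<nu> + 1) / (4 * (\<nu> + 1)) = \<nu>"
      using assms(1) by (subst nonzero_divide_eq_eq) (simp_all add: algebra_simps)
    ultimately show ?thesis unfolding add_divide_distrib by simp
  qed
  finally have le: "(4 * \<nu> * (\<nu> + 1) + (\<nu> + 2) * x) / (4 * (\<nu> + 1)) \<le> \<nu> * A + 2 * B" .
  \<comment> \<open>Completing the square.\<close>
  have "4 * \<nu> * (\<nu> + 1) + (\<nu> + 2) * x = (2 * \<nu> + 481 / 400)\<^sup>2 + (162 / 100 - (481 / 400)\<^sup>2)"
    by (simp add: x_def power2_eq_square field_simps)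
  also have "\<dots> > 0" by (rule add_nonneg_pos) (simp_all add: power2_eq_square)
  finally have pos: "\<nu> * A + 2 * B > 0"
    using assms(1) by (intro less_le_trans[OF _ le] divide_pos_pos) auto
  define z where "z = \<i> * complex_of_real (9 / 10)"
  have z: "z \<in> ball 0 1 - {0}" by (simp add: z_def norm_mult)
  have z2: "z\<^sup>2 = ?w" by (simp add: z_def x_def power_mult_distrib power_divide)
  have gt: "Re (z * deriv f z / f z) > \<alpha>"
    using f(2) z unfolding starlike_of_order_def by blast
  with assms(3) have "f z \<noteq> 0" by auto
  then have "z * deriv f z / f z = 1 + 2 / of_real \<nu> *
      (z\<^sup>2 * eval_fps (fps_deriv (bessel_fps \<nu>)) (z\<^sup>2) / eval_fps (bessel_fps \<nu>) (z\<^sup>2))"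
    using z assms f(1) \<open>A > 0\<close> unfolding z2
    by (intro bessel_f_starlike_quotient[of \<nu> f z, unfolded z2]) (simp_all add: Aw[simplified])
  also have "\<dots> = 1 + 2 / of_real \<nu> * (of_real B / of_real A)"
    unfolding z2 Aw Bw ..
  also have "\<dots> = of_real (1 + 2 / \<nu> * (B / A))" by simp
  also have "Re \<dots> = 1 + 2 / \<nu> * (B / A)" by (rule Re_complex_of_real)
  also have "\<dots> = (\<nu> * A + 2 * B) / (\<nu> * A)"
    using assms(2) \<open>A > 0\<close> by (simp add: field_simps)
  also have "\<dots> < 0"
    using pos assms(2) \<open>A > 0\<close> by (intro divide_pos_neg mult_neg_pos)
  finally show False using gt assms(3) by linarith
qed

lemma nu1_characterization:
  assumes "0 \<le> \<alpha>" "\<alpha> < 1"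
  shows "\<exists>!\<nu>. is_nu1 \<alpha> \<nu>" "nu1 \<alpha> > 0"
    "\<And>\<nu>. \<nu> > 0 \<Longrightarrow> 2 * rayleigh_sum \<nu> \<le> (1 - \<alpha>) * \<nu> \<longleftrightarrow> nu1 \<alpha> \<le> \<nu>"
proof -
  obtain \<mu> where \<mu>: "0 < \<mu>"
    "\<And>\<nu>. \<nu> > 0 \<Longrightarrow> (1 - \<alpha>) * \<nu> = 2 * rayleigh_sum \<nu> \<longleftrightarrow> \<nu> = \<mu>"
    "\<And>\<nu>. \<nu> > 0 \<Longrightarrow> 2 * rayleigh_sum \<nu> \<le> (1 - \<alpha>) * \<nu> \<longleftrightarrow> \<mu> \<le> \<nu>"
    using rayleigh_sum_crossing[OF assms] by metis
  have iff: "is_nu1 \<alpha> \<nu> \<longleftrightarrow> \<nu> = \<mu>" for \<nu>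
    using \<mu>(1,2) by (auto simp: is_nu1_iff)
  then show "\<exists>!\<nu>. is_nu1 \<alpha> \<nu>" by simp
  have "nu1 \<alpha> = \<mu>" unfolding nu1_def iff by simp
  with \<mu> show "nu1 \<alpha> > 0"
    "\<And>\<nu>. \<nu> > 0 \<Longrightarrow> 2 * rayleigh_sum \<nu> \<le> (1 - \<alpha>) * \<nu> \<longleftrightarrow> nu1 \<alpha> \<le> \<nu>" by auto
qed

lemma starlike_iff:
  assumes "0 \<le> \<alpha>" "\<alpha> < 1" "\<nu> > -1" "\<nu> \<noteq> 0"
  shows "(\<exists>f. is_bessel_f \<nu> f \<and> starlike_of_order \<alpha> f) \<longleftrightarrow> \<nu> \<ge> nu1 \<alpha>"
proof (cases "\<nu> > 0")
  case True
  with assms nu1_characterization(3)[of \<alpha> \<nu>] show ?thesis by (simp add: starlike_iff_pos)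
next
  case False
  with assms have "\<not> (\<exists>f. is_bessel_f \<nu> f \<and> starlike_of_order \<alpha> f)"
    using not_starlike_neg[of \<nu> \<alpha>] by auto
  moreover have "\<not> nu1 \<alpha> \<le> \<nu>"
    using False nu1_characterization(2)[OF assms(1,2)] by linarith
  ultimately show ?thesis by blast
qed

theorem theorem1:
  fixes \<alpha> :: real
  assumes "0 \<le> \<alpha>" and "\<alpha> < 1"
  shows "(\<exists>!\<nu>. is_nu1 \<alpha> \<nu>) \<and>
         (\<forall>\<nu>. \<nu> > -1 \<and> \<nu> \<noteq> 0 \<longrightarrow>
            ((\<exists>f. is_bessel_f \<nu> f \<and> starlike_of_order \<alpha> f) \<longleftrightarrow> \<nu> \<ge> nu1 \<alpha>)) \<and>
         (\<exists>!\<nu>. is_nu1 0 \<nu>) \<and>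
         (\<forall>\<nu>. \<nu> > -1 \<and> \<nu> \<noteq> 0 \<longrightarrow>
            ((\<exists>f. is_bessel_f \<nu> f \<and> starlike_of_order 0 f) \<longleftrightarrow> \<nu> \<ge> nu1 0)) \<and>
         0.3900 < nu1 0 \<and> nu1 0 < 0.3901"
proof -
  have "\<exists>!\<nu>. is_nu1 \<alpha> \<nu>" "\<exists>!\<nu>. is_nu1 0 \<nu>"
    by (rule nu1_characterization(1); use assms in simp)+
  moreover have "0.3900 < nu1 0"
    using nu1_characterization(3)[of 0 "39 / 100"] rayleigh_sum_numeric_lower by simp
  \<comment> \<open>The characterization gives only a weak inequality; equality would contradict the strict
    numerical bound.\<close>
  moreover have "nu1 0 < 0.3901"
  proof -
    have "2 * rayleigh_sum (nu1 0) = nu1 0"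
      using theI'[OF nu1_characterization(1)[of 0], folded nu1_def] by (simp add: is_nu1_iff)
    then have "nu1 0 \<noteq> 3901 / 10000" using rayleigh_sum_numeric_upper by (metis less_irrefl)
    with nu1_characterization(3)[of 0 "3901 / 10000"] rayleigh_sum_numeric_upper show ?thesis by simp
  qed
  ultimately show ?thesis using assms by (simp add: starlike_iff)
qed

end
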